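(* Let $X$ be a separable metrizable space and let $G$ be a group of homeomorphisms of $X$ such that the orbit space $G\backslash X$ is a paracompact regular space. If $G$ is equiregular, then $G$ is singly isometrizable.
   Context: Let $X$ be a topological space and $G$ a group of homeomorphisms of $X$. $G\backslash X$ denotes the orbit space with the quotient topology. Paracompact means that every open cover has a locally finite open refinement (Hausdorffness is NOT part of the definition). Regular means: for every point $x$ and every open neighborhood $U$ of $x$ there is an open neighborhood $V$ of $x$ with $\mathrm{cl}(V)\subset U$ (no further separation axiom is included). $G$ is singly isometrizable if there is a metric $\rho: X\times X\to[0,\infty)$ that determines the given topology of $X$ and is $G$-invariant, i.e. $\rho(g(x),g(y))=\rho(x,y)$ for all $x,y\in X$ and $g\in G$. $G$ is equiregular if for every $x\in X$ and every open neighborhood $U$ of $x$ in $X$ there is an open neighborhood $V$ of $x$ in $X$ such that $\mathrm{cl}(V)\subset U$ and every $y\in X$ has an open neighborhood $N_y$ with the property that for every $g\in G$, if $g(N_y)\cap\mathrm{cl}(V)\ne\emptyset$, then $g(N_y)\subset U$. *)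

theory Defs
  imports "HOL-Analysis.Analysis" "HOL-Algebra.Bij"
begin

no_notation eq_closure_of ("closure'_of\<index>")  (* clashes with the topological closure *)

text \<open>
  Spaces are abstract topologies \<open>X :: 'a topology\<close> with underlying set \<open>topspace X\<close>.
  A group of homeomorphisms of \<open>X\<close> is a subgroup of the group of all bijections of
  \<open>topspace X\<close> whose members are homeomorphisms.  Elements of \<open>BijGroup\<close> are
  extensional, so a self-map of \<open>topspace X\<close> is represented by exactly one HOL function.
\<close>

definition homeomorphism_group_on :: "'a topology \<Rightarrow> ('a \<Rightarrow> 'a) set \<Rightarrow> bool" where
  "homeomorphism_group_on X G \<longleftrightarrow>
     subgroup G (BijGroup (topspace X)) \<and> (\<forall>g\<in>G. homeomorphic_map X X g)"

definition orbit_of :: "('a \<Rightarrow> 'a) set \<Rightarrow> 'a \<Rightarrow> 'a set" where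
  "orbit_of G x = (\<lambda>g. g x) ` G"

definition orbit_space :: "'a topology \<Rightarrow> ('a \<Rightarrow> 'a) set \<Rightarrow> 'a set topology" where
  "orbit_space X G =
     topology (\<lambda>W. W \<subseteq> orbit_of G ` topspace X \<and> openin X {x \<in> topspace X. orbit_of G x \<in> W})"

lemma openin_orbit_space:
  "openin (orbit_space X G) W \<longleftrightarrow>
     W \<subseteq> orbit_of G ` topspace X \<and> openin X {x \<in> topspace X. orbit_of G x \<in> W}"
proof -
  let ?P = "\<lambda>W. W \<subseteq> orbit_of G ` topspace X \<and> openin X {x \<in> topspace X. orbit_of G x \<in> W}"
  have "istopology ?P"
    unfolding istopology_def
  proof (intro conjI allI impI)
    fix S T assume S: "?P S" and T: "?P T"
    then show "S \<inter> T \<subseteq> orbit_of G ` topspace X" by blast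
    have "{x \<in> topspace X. orbit_of G x \<in> S \<inter> T} =
          {x \<in> topspace X. orbit_of G x \<in> S} \<inter> {x \<in> topspace X. orbit_of G x \<in> T}" by blast
    then show "openin X {x \<in> topspace X. orbit_of G x \<in> S \<inter> T}"
      using S T by (simp add: openin_Int)
  next
    fix \<K> assume K: "\<forall>K\<in>\<K>. ?P K"
    then show "\<Union>\<K> \<subseteq> orbit_of G ` topspace X" by blast
    have "{x \<in> topspace X. orbit_of G x \<in> \<Union>\<K>} =
          \<Union>((\<lambda>K. {x \<in> topspace X. orbit_of G x \<in> K}) ` \<K>)" by blast
    moreover have "openin X (\<Union>((\<lambda>K. {x \<in> topspace X. orbit_of G x \<in> K}) ` \<K>))"
      using K by (intro openin_Union) blast
    ultimately show "openin X {x \<in> topspace X. orbit_of G x \<in> \<Union>\<K>}" by simp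
  qed
  then show ?thesis
    unfolding orbit_space_def by (simp add: topology_inverse')
qed

lemma topspace_orbit_space: "topspace (orbit_space X G) = orbit_of G ` topspace X"
proof
  show "topspace (orbit_space X G) \<subseteq> orbit_of G ` topspace X"
    using openin_topspace[of "orbit_space X G"] unfolding openin_orbit_space by (rule conjunct1)
  have "{x \<in> topspace X. orbit_of G x \<in> orbit_of G ` topspace X} = topspace X" by blast
  then have "openin (orbit_space X G) (orbit_of G ` topspace X)"
    by (simp add: openin_orbit_space)
  then show "orbit_of G ` topspace X \<subseteq> topspace (orbit_space X G)"
    by (rule openin_subset)
qed

lemma quotient_map_orbit_space: "quotient_map X (orbit_space X G) (orbit_of G)"
  by (simp add: quotient_map_def topspace_orbit_space openin_orbit_space)

definition paracompact_space :: "'a topology \<Rightarrow> bool" where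
  "paracompact_space X \<longleftrightarrow>
     (\<forall>\<U>. (\<forall>U\<in>\<U>. openin X U) \<and> \<Union>\<U> = topspace X \<longrightarrow>
        (\<exists>\<V>. (\<forall>V\<in>\<V>. openin X V) \<and> \<Union>\<V> = topspace X \<and>
             (\<forall>V\<in>\<V>. \<exists>U\<in>\<U>. V \<subseteq> U) \<and> locally_finite_in X \<V>))"

text \<open>The library notion \<open>regular_space\<close> contains no separation axiom beyond the following.\<close>

lemma regular_space_closure_of:
  "regular_space X \<longleftrightarrow>
     (\<forall>x\<in>topspace X. \<forall>U. openin X U \<and> x \<in> U \<longrightarrow>
        (\<exists>V. openin X V \<and> x \<in> V \<and> X closure_of V \<subseteq> U))"
proof (intro iffI ballI allI impI)
  fix x U assume reg: "regular_space X" and "x \<in> topspace X" and U: "openin X U \<and> x \<in> U"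
  then have "closedin X (topspace X - U)" "x \<in> topspace X - (topspace X - U)" by auto
  then obtain V W where VW: "openin X V" "openin X W" "x \<in> V" "topspace X - U \<subseteq> W" "disjnt V W"
    using reg unfolding regular_space_def by meson
  have "X closure_of V \<subseteq> topspace X - W"
    using VW by (intro closure_of_minimal) (auto simp: disjnt_iff dest: openin_subset)
  then show "\<exists>V. openin X V \<and> x \<in> V \<and> X closure_of V \<subseteq> U"
    using VW by blast
next
  assume *: "\<forall>x\<in>topspace X. \<forall>U. openin X U \<and> x \<in> U \<longrightarrow>
        (\<exists>V. openin X V \<and> x \<in> V \<and> X closure_of V \<subseteq> U)"
  show "regular_space X"
    unfolding regular_space_def
  proof (intro allI impI)
    fix C a assume C: "closedin X C \<and> a \<in> topspace X - C"
    then have "openin X (topspace X - C)" "a \<in> topspace X - C" "a \<in> topspace X"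
      by (simp_all add: openin_diff)
    then obtain V where V: "openin X V" "a \<in> V" "X closure_of V \<subseteq> topspace X - C"
      using * by meson
    have "openin X (topspace X - X closure_of V)" by (simp add: openin_diff)
    moreover have "C \<subseteq> topspace X - X closure_of V"
      using V(3) closedin_subset[of X C] C by blast
    moreover have "disjnt V (topspace X - X closure_of V)"
      using V by (auto simp: disjnt_iff dest: closure_of_subset[OF openin_subset])
    ultimately show "\<exists>U V. openin X U \<and> openin X V \<and> a \<in> U \<and> C \<subseteq> V \<and> disjnt U V"
      using V by blast
  qed
qed

definition singly_isometrizable :: "'a topology \<Rightarrow> ('a \<Rightarrow> 'a) set \<Rightarrow> bool" where
  "singly_isometrizable X G \<longleftrightarrow>
     (\<exists>\<rho>. Metric_space (topspace X) \<rho> \<and>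
          Metric_space.mtopology (topspace X) \<rho> = X \<and>
          (\<forall>g\<in>G. \<forall>x\<in>topspace X. \<forall>y\<in>topspace X. \<rho> (g x) (g y) = \<rho> x y))"

definition equiregular :: "'a topology \<Rightarrow> ('a \<Rightarrow> 'a) set \<Rightarrow> bool" where
  "equiregular X G \<longleftrightarrow>
     (\<forall>x\<in>topspace X. \<forall>U. openin X U \<and> x \<in> U \<longrightarrow>
        (\<exists>V. openin X V \<and> x \<in> V \<and> X closure_of V \<subseteq> U \<and>
             (\<forall>y\<in>topspace X. \<exists>N. openin X N \<and> y \<in> N \<and>
                (\<forall>g\<in>G. g ` N \<inter> X closure_of V \<noteq> {} \<longrightarrow> g ` N \<subseteq> U))))"

end

theory Submission
  imports Defs
begin

text \<open>
  Call \<open>E \<subseteq> X \<times> X\<close> an equi-neighbourhood of the diagonal if every point has an open neighbourhood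
  \<open>N\<close> with \<open>g N \<times> g N \<subseteq> E\<close> for all \<open>g \<in> G\<close>.  Equiregularity makes these relations separate points
  from closed sets; with paracompactness and regularity of the orbit space it also provides, for
  each \<open>E\<close>, an invariant symmetric \<open>F\<close> of the same kind with \<open>F O F \<subseteq> E\<close>.  By second countability a
  sequence \<open>F\<^sub>n\<close> of invariant relations with \<open>F\<^sub>n\<^sub>+\<^sub>1 O F\<^sub>n\<^sub>+\<^sub>1 O F\<^sub>n\<^sub>+\<^sub>1 \<subseteq> F\<^sub>n\<close> already determines the
  topology, and Frink's chain construction turns it into an invariant metric.
\<close>

section \<open>Metrization of a sequence of relations\<close>

text \<open>A chain is recorded only by the indices of its links; the intermediate points are hidden
  in the relational composition. Concatenation and reversal of chains become append and
  \<open>rev\<close>.\<close>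

definition chain :: "(nat \<Rightarrow> 'a rel) \<Rightarrow> nat list \<Rightarrow> 'a rel" where
  "chain F ns = foldr (\<lambda>n R. F n O R) ns Id"

definition cost :: "nat list \<Rightarrow> real" where
  "cost ns = (\<Sum>n\<leftarrow>ns. (1/2) ^ n)"

definition chain_dist :: "(nat \<Rightarrow> 'a rel) \<Rightarrow> 'a \<Rightarrow> 'a \<Rightarrow> real" where
  "chain_dist F x y = Inf {cost ns | ns. (x, y) \<in> chain F ns}"

lemma chain_simps [simp]:
  "chain F [] = Id" "chain F (n # ns) = F n O chain F ns"
  by (simp_all add: chain_def)

lemma chain_append [simp]: "chain F (ms @ ns) = chain F ms O chain F ns"
  by (induction ms) (auto simp: O_assoc)

lemma cost_simps [simp]:
  "cost [] = 0" "cost (n # ns) = (1/2) ^ n + cost ns" "cost (ms @ ns) = cost ms + cost ns"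
  by (simp_all add: cost_def)

lemma cost_nonneg: "0 \<le> cost ns"
  by (induction ns) auto

lemma cost_rev [simp]: "cost (rev ns) = cost ns"
  by (induction ns) auto

lemma chain_rev:
  assumes "\<And>n. sym (F n)"
  shows "(x, y) \<in> chain F ns \<Longrightarrow> (y, x) \<in> chain F (rev ns)"
proof (induction ns arbitrary: x)
  case (Cons n ns)
  then obtain z where "(x, z) \<in> F n" "(z, y) \<in> chain F ns" by auto
  then show ?case using Cons.IH[of z] assms[of n] by (auto dest: symD)
qed simp

lemma chain_map:
  assumes "\<And>n x y. (x, y) \<in> F n \<Longrightarrow> (h x, h y) \<in> F n"
  shows "(x, y) \<in> chain F ns \<Longrightarrow> (h x, h y) \<in> chain F ns"
  by (induction ns arbitrary: x) (auto dest: assms)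

text \<open>Cutting a chain at half its cost leaves two cheap parts joined by a single link.\<close>

lemma cost_split:
  assumes "0 \<le> t" "t < cost ns"
  shows "\<exists>as m bs. ns = as @ m # bs \<and> cost as \<le> t \<and> t < cost as + (1/2) ^ m"
  using assms
proof (induction ns arbitrary: t)
  case (Cons n ns)
  show ?case
  proof (cases "t < (1/2) ^ n")
    case True
    then show ?thesis using Cons.prems by (intro exI[of _ "[]"]) auto
  next
    case False
    then obtain as m bs where "ns = as @ m # bs" "cost as \<le> t - (1/2) ^ n"
        "t - (1/2) ^ n < cost as + (1/2) ^ m"
      using Cons.IH[of "t - (1/2) ^ n"] Cons.prems by auto
    then show ?thesis by (intro exI[of _ "n # as"] exI[of _ m] exI[of _ bs]) auto
  qed
qed simp

text \<open>The composition is triple because a chain cut at half its cost falls into a left part,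
  one link and a right part. \<open>F 0 = UNIV\<close> joins any two points by a link of cost 1, so
  that distances are infima of nonempty sets.\<close>

locale frink_sequence =
  fixes F :: "nat \<Rightarrow> 'a rel"
  assumes F_0: "F 0 = UNIV"
    and F_refl: "(x, x) \<in> F n"
    and F_sym: "sym (F n)"
    and F_comp: "F (Suc n) O F (Suc n) O F (Suc n) \<subseteq> F n"
begin

lemma F_antimono: "m \<le> n \<Longrightarrow> F n \<subseteq> F m"
proof (induction rule: dec_induct)
  case (step n)
  have "F (Suc n) \<subseteq> F n"
    using F_comp[of n] F_refl[of _ "Suc n"] by (meson relcompI subrelI subsetD)
  then show ?case using step.IH by blast
qed simp

text \<open>Frink's estimate, by induction on the length. After a cut at half the cost both outer
  parts cost less than \<open>(1/2) ^ Suc n\<close>, so they lie in \<open>F (Suc n)\<close> by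
  induction; the middle link costs less than \<open>(1/2) ^ n\<close>, so its index exceeds
  \<open>n\<close> and it lies in \<open>F (Suc n)\<close> too. \<open>F_comp\<close> joins the
  three.\<close>

lemma chain_in_F: "(x, y) \<in> chain F ns \<Longrightarrow> cost ns < (1/2) ^ n \<Longrightarrow> (x, y) \<in> F n"
proof (induction ns arbitrary: x y n rule: length_induct)
  case (1 ns)
  show ?case
  proof (cases "ns = []")
    case True
    then show ?thesis using 1 by (simp add: F_refl)
  next
    case False
    \<comment> \<open>Positivity gives \<open>cost ns / 2 < cost ns\<close>, which
      \<open>cost_split\<close> demands.\<close>
    then have pos: "0 < cost ns"
      by (cases ns) (use cost_nonneg in \<open>auto simp: add_pos_nonneg\<close>)
    then obtain as m bs where ns: "ns = as @ m # bs"
        and as: "cost as \<le> cost ns / 2" and m: "cost ns / 2 < cost as + (1/2) ^ m"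
      using cost_split[of "cost ns / 2" ns] by auto
    have bs: "cost bs < (1/2) ^ Suc n" and as': "cost as < (1/2) ^ Suc n"
      using as m 1(3) by (simp_all add: ns)
    have "(1/2 :: real) ^ m < (1/2) ^ n"
      using 1(3) cost_nonneg[of as] cost_nonneg[of bs] unfolding ns cost_simps by linarith
    then have "n < m"
      by (simp add: power_strict_decreasing_iff)
    obtain u v where uv: "(x, u) \<in> chain F as" "(u, v) \<in> F m" "(v, y) \<in> chain F bs"
      using 1(2) by (auto simp: ns)
    have "(x, u) \<in> F (Suc n)" "(v, y) \<in> F (Suc n)"
      using 1(1)[rule_format, OF _ uv(1) as'] 1(1)[rule_format, OF _ uv(3) bs]
      by (simp_all add: ns)
    moreover have "(u, v) \<in> F (Suc n)"
      using F_antimono[of "Suc n" m] \<open>n < m\<close> uv by auto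
    ultimately have "(x, y) \<in> F (Suc n) O F (Suc n) O F (Suc n)" by blast
    then show ?thesis using F_comp[of n] by (rule subsetD[rotated])
  qed
qed

lemma costs_nonempty: "{cost ns | ns. (x, y) \<in> chain F ns} \<noteq> {}"
proof -
  have "(x, y) \<in> chain F [0]" by (simp add: F_0)
  then show ?thesis by blast
qed

lemma costs_bdd_below: "bdd_below {cost ns | ns. (x, y) \<in> chain F ns}"
  by (rule bdd_belowI[of _ 0]) (auto simp: cost_nonneg)

lemma chain_dist_le: "(x, y) \<in> chain F ns \<Longrightarrow> chain_dist F x y \<le> cost ns"
  unfolding chain_dist_def by (rule cInf_lower[OF _ costs_bdd_below]) blast

lemma chain_dist_greatest:
  "(\<And>ns. (x, y) \<in> chain F ns \<Longrightarrow> c \<le> cost ns) \<Longrightarrow> c \<le> chain_dist F x y"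
  unfolding chain_dist_def by (rule cInf_greatest[OF costs_nonempty]) blast

lemma chain_dist_less:
  assumes "chain_dist F x y < c"
  obtains ns where "(x, y) \<in> chain F ns" "cost ns < c"
  using chain_dist_greatest[of x y c] assms by (meson leD leI)

lemma chain_dist_nonneg: "0 \<le> chain_dist F x y"
  by (rule chain_dist_greatest) (rule cost_nonneg)

lemma chain_dist_self: "chain_dist F x x = 0"
  using chain_dist_le[of x x "[]"] chain_dist_nonneg[of x x] by simp

lemma chain_dist_map:
  assumes "\<And>n x y. (x, y) \<in> F n \<Longrightarrow> (h x, h y) \<in> F n"
  shows "chain_dist F (h x) (h y) \<le> chain_dist F x y"
proof (rule chain_dist_greatest)
  fix ns assume "(x, y) \<in> chain F ns"
  then have "(h x, h y) \<in> chain F ns" using chain_map[of F h x y ns] assms by blast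
  then show "chain_dist F (h x) (h y) \<le> cost ns" by (rule chain_dist_le)
qed

lemma chain_dist_commute: "chain_dist F x y = chain_dist F y x"
proof -
  have "chain_dist F x y \<le> chain_dist F y x" for x y
  proof (rule chain_dist_greatest)
    fix ns assume "(y, x) \<in> chain F ns"
    then have "(x, y) \<in> chain F (rev ns)" by (rule chain_rev[OF F_sym])
    then show "chain_dist F x y \<le> cost ns" using chain_dist_le by fastforce
  qed
  then show ?thesis by (simp add: antisym)
qed

lemma chain_dist_triangle: "chain_dist F x z \<le> chain_dist F x y + chain_dist F y z"
proof -
  have "chain_dist F x z - chain_dist F x y \<le> chain_dist F y z"
  proof (rule chain_dist_greatest)
    fix ns assume ns: "(y, z) \<in> chain F ns"
    have "chain_dist F x z - cost ns \<le> chain_dist F x y"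
    proof (rule chain_dist_greatest)
      fix ms assume "(x, y) \<in> chain F ms"
      then have "(x, z) \<in> chain F (ms @ ns)" using ns by auto
      then show "chain_dist F x z - cost ns \<le> cost ms" using chain_dist_le by fastforce
    qed
    then show "chain_dist F x z - chain_dist F x y \<le> cost ns" by simp
  qed
  then show ?thesis by simp
qed

lemma chain_dist_le_power: "(x, y) \<in> F n \<Longrightarrow> chain_dist F x y \<le> (1/2) ^ n"
  using chain_dist_le[of x y "[n]"] by simp

text \<open>With \<open>chain_dist_le_power\<close>, this squeezes \<open>F n\<close> between the
  open and the closed balls of radius \<open>(1/2) ^ n\<close>, so relations and distance define the
  same neighbourhoods.\<close>

lemma chain_dist_less_power: "chain_dist F x y < (1/2) ^ n \<Longrightarrow> (x, y) \<in> F n"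
  by (metis chain_dist_less chain_in_F)

end


section \<open>Topological preliminaries\<close>

lemma separable_metrizable_imp_second_countable:
  assumes "separable_space X" "metrizable_space X"
  shows "second_countable X"
proof -
  obtain M d where Md: "Metric_space M d" and X: "X = Metric_space.mtopology M d"
    using assms(2) unfolding metrizable_space_def by blast
  interpret Metric_space M d by (rule Md)
  obtain C where C: "countable C" "C \<subseteq> M" "mtopology closure_of C = M"
    using assms(1) unfolding separable_space_def X by auto
  define \<B> where "\<B> = (\<lambda>(c, n). mball c (inverse (real (Suc n)))) ` (C \<times> (UNIV :: nat set))"
  have base: "\<exists>V\<in>\<B>. x \<in> V \<and> V \<subseteq> U" if "openin mtopology U" "x \<in> U" for U x
  proof -
    obtain r where r: "r > 0" "mball x r \<subseteq> U" and "x \<in> M"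
      using \<open>openin mtopology U\<close> \<open>x \<in> U\<close> unfolding openin_mtopology by blast
    \<comment> \<open>Half of \<open>r\<close>, since the way from \<open>x\<close> to the centre
      \<open>c\<close> and on to a point of its ball costs one radius each.\<close>
    obtain n where n: "inverse (real (Suc n)) < r / 2"
      using r reals_Archimedean[of "r / 2"] by auto
    let ?s = "inverse (real (Suc n))"
    have "0 < ?s" by simp
    then obtain c where c: "c \<in> C" "c \<in> mball x ?s"
      using C(3) \<open>x \<in> M\<close> unfolding metric_closure_of by blast
    have "mball c ?s \<subseteq> mball x r"
    proof
      fix y assume y: "y \<in> mball c ?s"
      have "d x y \<le> d x c + d c y" using y c by (intro triangle) auto
      then show "y \<in> mball x r" using y c n by auto
    qed
    moreover have "x \<in> mball c ?s" using c by (simp add: commute)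
    moreover have "mball c ?s \<in> \<B>" using c(1) by (auto simp: \<B>_def)
    ultimately show ?thesis using r(2) by blast
  qed
  show ?thesis
    unfolding second_countable_def X
  proof (intro exI[of _ \<B>] conjI allI impI ballI)
    show "countable \<B>" using C(1) by (simp add: \<B>_def)
    show "openin mtopology V" if "V \<in> \<B>" for V
      using that unfolding \<B>_def by (elim imageE) (simp add: split_beta)
    show "\<exists>V\<in>\<B>. x \<in> V \<and> V \<subseteq> U" if "openin mtopology U \<and> x \<in> U" for U x
      using that by (intro base) simp_all
  qed
qed

text \<open>By regularity, the open sets whose closures lie in members of the cover form a cover as
  well. The closures of a locally finite open refinement of it stay locally finite and fit into the
  given cover.\<close>

lemma paracompact_regular_closed_refinement:
  assumes "paracompact_space Q" "regular_space Q"
    and U: "\<forall>U\<in>\<U>. openin Q U" "\<Union>\<U> = topspace Q"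
  obtains \<C> where "\<And>C. C \<in> \<C> \<Longrightarrow> closedin Q C" "\<Union>\<C> = topspace Q"
    "\<And>C. C \<in> \<C> \<Longrightarrow> \<exists>U\<in>\<U>. C \<subseteq> U" "locally_finite_in Q \<C>"
proof -
  define \<A> where "\<A> = {A. openin Q A \<and> (\<exists>U\<in>\<U>. Q closure_of A \<subseteq> U)}"
  have "\<Union>\<A> = topspace Q"
  proof
    show "\<Union>\<A> \<subseteq> topspace Q" by (auto simp: \<A>_def dest: openin_subset)
    show "topspace Q \<subseteq> \<Union>\<A>"
    proof
      fix q assume q: "q \<in> topspace Q"
      then obtain U where "U \<in> \<U>" "q \<in> U" using U(2) by blast
      then obtain A where "openin Q A" "q \<in> A" "Q closure_of A \<subseteq> U"
        using assms(2) q U(1) unfolding regular_space_closure_of by meson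
      then show "q \<in> \<Union>\<A>" using \<open>U \<in> \<U>\<close> by (auto simp: \<A>_def)
    qed
  qed
  then have A: "(\<forall>A\<in>\<A>. openin Q A) \<and> \<Union>\<A> = topspace Q" by (simp add: \<A>_def)
  obtain \<V> where V: "\<forall>V\<in>\<V>. openin Q V" "\<Union>\<V> = topspace Q"
      "\<forall>V\<in>\<V>. \<exists>A\<in>\<A>. V \<subseteq> A" "locally_finite_in Q \<V>"
    using assms(1)[unfolded paracompact_space_def, THEN spec, THEN mp, OF A]
    by (elim exE conjE) (rule that)
  show thesis
  proof (rule that[of "(\<lambda>V. Q closure_of V) ` \<V>"])
    show "\<Union>((\<lambda>V. Q closure_of V) ` \<V>) = topspace Q"
    proof
      show "\<Union>((\<lambda>V. Q closure_of V) ` \<V>) \<subseteq> topspace Q"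
        by (intro UN_least closure_of_subset_topspace)
      show "topspace Q \<subseteq> \<Union>((\<lambda>V. Q closure_of V) ` \<V>)"
      proof
        fix q assume "q \<in> topspace Q"
        then obtain V where "V \<in> \<V>" "q \<in> V" using V(2) by blast
        moreover have "V \<subseteq> Q closure_of V"
          using V(1) \<open>V \<in> \<V>\<close> by (simp add: closure_of_subset openin_subset)
        ultimately show "q \<in> \<Union>((\<lambda>V. Q closure_of V) ` \<V>)" by blast
      qed
    qed
    show "\<exists>U\<in>\<U>. C \<subseteq> U" if "C \<in> (\<lambda>V. Q closure_of V) ` \<V>" for C
    proof -
      obtain V where "V \<in> \<V>" "C = Q closure_of V" using \<open>C \<in> _\<close> by blast
      moreover obtain A where "A \<in> \<A>" "V \<subseteq> A" using V(3) \<open>V \<in> \<V>\<close> by blast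
      moreover obtain U where "U \<in> \<U>" "Q closure_of A \<subseteq> U"
        using \<open>A \<in> \<A>\<close> by (auto simp: \<A>_def)
      ultimately show ?thesis using closure_of_mono[of V A Q] by blast
    qed
    show "locally_finite_in Q ((\<lambda>V. Q closure_of V) ` \<V>)"
      by (rule locally_finite_in_closure[OF V(4)])
  qed auto
qed


section \<open>Invariant neighbourhoods of the diagonal\<close>

locale homeo_group =
  fixes X :: "'a topology" and G :: "('a \<Rightarrow> 'a) set"
  assumes G: "homeomorphism_group_on X G"
begin

section \<open>Group elements as maps, and their orbits\<close>

lemma subgroup_G: "subgroup G (BijGroup (topspace X))"
  using G by (simp add: homeomorphism_group_on_def)

lemma in_topspace: "g \<in> G \<Longrightarrow> x \<in> topspace X \<Longrightarrow> g x \<in> topspace X"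
  using G by (metis homeomorphism_group_on_def homeomorphic_imp_surjective_map imageI)

lemma openin_image: "g \<in> G \<Longrightarrow> openin X U \<Longrightarrow> openin X (g ` U)"
  using G by (metis homeomorphism_group_on_def homeomorphic_imp_open_map open_map_def)

text \<open>\<open>ex_one\<close>, \<open>ex_mult\<close> and \<open>ex_inv\<close> turn the
  operations of \<open>BijGroup\<close> into pointwise equations, stated on
  \<open>topspace X\<close> only because the group elements are extensional.\<close>

lemma ex_one:
  obtains e where "e \<in> G" "\<And>x. x \<in> topspace X \<Longrightarrow> e x = x"
proof
  show "(\<lambda>x\<in>topspace X. x) \<in> G"
    using subgroup.one_closed[OF subgroup_G] by (simp add: BijGroup_def)
qed simp

lemma in_Bij: "g \<in> G \<Longrightarrow> g \<in> Bij (topspace X)"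
  using subgroup.subset[OF subgroup_G] by (auto simp: BijGroup_def)

lemma ex_mult:
  assumes "g \<in> G" "h \<in> G"
  obtains k where "k \<in> G" "\<And>x. x \<in> topspace X \<Longrightarrow> k x = g (h x)"
proof
  show "compose (topspace X) g h \<in> G"
    using subgroup.m_closed[OF subgroup_G assms] in_Bij assms by (simp add: BijGroup_def)
qed (simp add: compose_def)

lemma ex_inv:
  assumes "g \<in> G"
  obtains h where "h \<in> G" "\<And>x. x \<in> topspace X \<Longrightarrow> h (g x) = x"
    "\<And>x. x \<in> topspace X \<Longrightarrow> g (h x) = x"
proof -
  interpret B: group "BijGroup (topspace X)" by (rule group_BijGroup)
  define h where "h = inv\<^bsub>BijGroup (topspace X)\<^esub> g"
  have h: "h \<in> G" unfolding h_def by (rule subgroup.m_inv_closed[OF subgroup_G assms])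
  have gc: "g \<in> carrier (BijGroup (topspace X))"
    using in_Bij[OF assms] by (simp add: BijGroup_def)
  have mult: "a \<otimes>\<^bsub>BijGroup (topspace X)\<^esub> b = compose (topspace X) a b"
    if "a \<in> G" "b \<in> G" for a b
    using that in_Bij by (simp add: BijGroup_def)
  have one: "\<one>\<^bsub>BijGroup (topspace X)\<^esub> x = x" if "x \<in> topspace X" for x
    using that by (simp add: BijGroup_def)
  have "compose (topspace X) h g = \<one>\<^bsub>BijGroup (topspace X)\<^esub>"
      "compose (topspace X) g h = \<one>\<^bsub>BijGroup (topspace X)\<^esub>"
    using B.l_inv[OF gc] B.r_inv[OF gc] mult[OF h assms] mult[OF assms h]
    unfolding h_def by simp_all
  then have "h (g x) = x" "g (h x) = x" if "x \<in> topspace X" for x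
    using one[OF that] compose_eq[OF that, of h g] compose_eq[OF that, of g h] by simp_all
  then show thesis by (rule that[OF h])
qed

lemma orbit_of_eq_iff:
  assumes "x \<in> topspace X" "y \<in> topspace X"
  shows "orbit_of G x = orbit_of G y \<longleftrightarrow> (\<exists>g\<in>G. g x = y)"
proof
  assume "orbit_of G x = orbit_of G y"
  moreover have "y \<in> orbit_of G y"
    using ex_one assms(2) unfolding orbit_of_def by (metis imageI)
  ultimately have "y \<in> orbit_of G x" by simp
  then show "\<exists>g\<in>G. g x = y" by (auto simp: orbit_of_def)
next
  have sub: "orbit_of G (g x) \<subseteq> orbit_of G x" if gx: "g \<in> G" "x \<in> topspace X" for g x
  proof
    fix z assume "z \<in> orbit_of G (g x)"
    then obtain h where "h \<in> G" "z = h (g x)" by (auto simp: orbit_of_def)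
    moreover obtain k where "k \<in> G" "k x = h (g x)"
      using ex_mult[OF \<open>h \<in> G\<close> \<open>g \<in> G\<close>] gx(2) by metis
    ultimately show "z \<in> orbit_of G x"
      unfolding orbit_of_def by (intro image_eqI[of _ _ k]) simp_all
  qed
  assume "\<exists>g\<in>G. g x = y"
  then obtain g where g: "g \<in> G" "g x = y" by blast
  then obtain h where h: "h \<in> G" "h y = x" using ex_inv[OF \<open>g \<in> G\<close>] assms(1) by metis
  have "orbit_of G y \<subseteq> orbit_of G x" using sub[OF g(1) assms(1)] g(2) by simp
  moreover have "orbit_of G x \<subseteq> orbit_of G y" using sub[OF h(1) assms(2)] h(2) by simp
  ultimately show "orbit_of G x = orbit_of G y" by (rule antisym[rotated])
qed

lemma orbit_of_image:
  assumes "g \<in> G" "x \<in> topspace X"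
  shows "orbit_of G (g x) = orbit_of G x"
  using orbit_of_eq_iff[OF assms(2) in_topspace[OF assms]] assms(1) by auto

text \<open>The preimage of the image of \<open>V\<close> is the union of the translates of
  \<open>V\<close>, each of them open.\<close>

lemma openin_orbit_image:
  assumes "openin X V"
  shows "openin (orbit_space X G) (orbit_of G ` V)"
proof -
  have V: "V \<subseteq> topspace X" by (rule openin_subset[OF assms])
  have "{x \<in> topspace X. orbit_of G x \<in> orbit_of G ` V} = (\<Union>g\<in>G. g ` V)" (is "?L = ?R")
  proof
    show "?L \<subseteq> ?R"
    proof
      fix x assume x: "x \<in> ?L"
      then obtain v where "v \<in> V" "orbit_of G v = orbit_of G x" by auto
      moreover have "v \<in> topspace X" using \<open>v \<in> V\<close> V by blast
      ultimately obtain g where "g \<in> G" "g v = x"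
        using orbit_of_eq_iff[of v x] x by auto
      then show "x \<in> ?R" using \<open>v \<in> V\<close> by auto
    qed
    show "?R \<subseteq> ?L"
    proof
      fix x assume "x \<in> ?R"
      then obtain g v where "g \<in> G" "v \<in> V" "x = g v" by auto
      moreover have "v \<in> topspace X" using \<open>v \<in> V\<close> V by blast
      ultimately show "x \<in> ?L"
        using in_topspace[of g v] orbit_of_image[of g v] by simp
    qed
  qed
  moreover have "openin X ?R"
    using openin_image[OF _ assms] by (intro openin_Union) auto
  ultimately show ?thesis using V by (auto simp: openin_orbit_space)
qed

text \<open>One \<open>N\<close> has to serve all \<open>g\<close> at once, which is stronger than
  being a neighbourhood of the diagonal. Pairs outside \<open>topspace X\<close> are allowed, so
  that \<open>UNIV\<close> and relations given by an implication qualify.\<close>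

definition equi_nhd :: "'a rel \<Rightarrow> bool" where
  "equi_nhd E \<longleftrightarrow>
     (\<forall>y\<in>topspace X. \<exists>N. openin X N \<and> y \<in> N \<and> (\<forall>g\<in>G. g ` N \<times> g ` N \<subseteq> E))"

lemma equi_nhd_UNIV: "equi_nhd UNIV"
  unfolding equi_nhd_def by blast

lemma equi_nhd_mono: "equi_nhd E \<Longrightarrow> E \<subseteq> F \<Longrightarrow> equi_nhd F"
  unfolding equi_nhd_def by (meson order_trans)

lemma equi_nhd_Int:
  assumes "equi_nhd E" "equi_nhd F"
  shows "equi_nhd (E \<inter> F)"
  unfolding equi_nhd_def
proof
  fix y assume "y \<in> topspace X"
  then obtain M N where "openin X M" "y \<in> M" "\<forall>g\<in>G. g ` M \<times> g ` M \<subseteq> E"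
      "openin X N" "y \<in> N" "\<forall>g\<in>G. g ` N \<times> g ` N \<subseteq> F"
    using assms unfolding equi_nhd_def by meson
  then show "\<exists>N. openin X N \<and> y \<in> N \<and> (\<forall>g\<in>G. g ` N \<times> g ` N \<subseteq> E \<inter> F)"
    by (intro exI[of _ "M \<inter> N"]) (fastforce simp: openin_Int)
qed

lemma equi_nhd_refl:
  assumes "equi_nhd E" "x \<in> topspace X"
  shows "(x, x) \<in> E"
proof -
  obtain N where "x \<in> N" "\<forall>g\<in>G. g ` N \<times> g ` N \<subseteq> E"
    using assms unfolding equi_nhd_def by meson
  moreover obtain e where "e \<in> G" "e x = x" using ex_one assms(2) by metis
  ultimately show ?thesis by force
qed

text \<open>The identity of \<open>G\<close> is among the \<open>g\<close>, so \<open>N\<close>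
  itself works. This later puts an open set of \<open>X\<close> into every metric ball.\<close>

lemma equi_nhd_nhd:
  assumes "equi_nhd E" "x \<in> topspace X"
  obtains N where "openin X N" "x \<in> N" "\<And>y. y \<in> N \<Longrightarrow> (x, y) \<in> E"
proof -
  obtain N where N: "openin X N" "x \<in> N" "\<forall>g\<in>G. g ` N \<times> g ` N \<subseteq> E"
    using assms unfolding equi_nhd_def by meson
  obtain e where e: "e \<in> G" "\<And>x. x \<in> topspace X \<Longrightarrow> e x = x" using ex_one by metis
  have "(x, y) \<in> E" if "y \<in> N" for y
  proof -
    have "(e x, e y) \<in> E" using N e(1) that by blast
    moreover have "y \<in> topspace X" using N(1) that openin_subset by blast
    ultimately show ?thesis using e(2) assms(2) by simp
  qed
  with N show thesis using that by blast
qed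

definition invariant :: "'a rel \<Rightarrow> bool" where
  "invariant E \<longleftrightarrow>
     E \<subseteq> topspace X \<times> topspace X \<and> (\<forall>g\<in>G. \<forall>(x, y)\<in>E. (g x, g y) \<in> E)"

text \<open>\<open>g\<close> carries the translate by \<open>h\<close> to the translate by the
  product of \<open>g\<close> and \<open>h\<close>.\<close>

lemma invariant_Union:
  assumes "\<And>y. y \<in> topspace X \<Longrightarrow> W y \<subseteq> topspace X"
  shows "invariant (\<Union>y\<in>topspace X. \<Union>g\<in>G. g ` W y \<times> g ` W y)"
proof -
  have X: "h a \<in> topspace X" if "y \<in> topspace X" "h \<in> G" "a \<in> W y" for y h a
    using that assms[of y] in_topspace[of h a] by auto
  show ?thesis
    unfolding invariant_def
  proof (intro conjI ballI, goal_cases)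
    case 1
    show ?case using X by auto
  next
    case (2 g p)
    then obtain y h a b where y: "y \<in> topspace X" "h \<in> G" "a \<in> W y" "b \<in> W y"
        and p: "p = (h a, h b)" by auto
    obtain k where k: "k \<in> G" "\<And>x. x \<in> topspace X \<Longrightarrow> k x = g (h x)"
      using ex_mult[OF 2(1) y(2)] by metis
    have "a \<in> topspace X" "b \<in> topspace X" using y assms[of y] by auto
    then have "g (h a) \<in> k ` W y" "g (h b) \<in> k ` W y"
      using k(2) y(3,4) by (metis imageI)+
    then show ?case using k(1) y(1) p by auto
  qed
qed

section \<open>Consequences of equiregularity\<close>

lemma equiregular_nhds:
  assumes "equiregular X G" "openin X U" "x \<in> U"
  obtains V N where "openin X V" "x \<in> V"
    "\<And>y. y \<in> topspace X \<Longrightarrow> openin X (N y)" "\<And>y. y \<in> topspace X \<Longrightarrow> y \<in> N y"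
    "\<And>y g. y \<in> topspace X \<Longrightarrow> g \<in> G \<Longrightarrow> g ` N y \<inter> V \<noteq> {} \<Longrightarrow> g ` N y \<subseteq> U"
proof -
  have x: "x \<in> topspace X" using openin_subset[OF assms(2)] assms(3) by blast
  obtain V where V: "openin X V" "x \<in> V"
      and N: "\<forall>y\<in>topspace X. \<exists>N. openin X N \<and> y \<in> N \<and>
         (\<forall>g\<in>G. g ` N \<inter> X closure_of V \<noteq> {} \<longrightarrow> g ` N \<subseteq> U)"
    using assms(1)[unfolded equiregular_def, THEN bspec, OF x, THEN spec, THEN mp,
        OF conjI[OF assms(2,3)]]
    by (elim exE conjE) (rule that)
  obtain N where N: "\<forall>y\<in>topspace X. openin X (N y) \<and> y \<in> N y \<and>
         (\<forall>g\<in>G. g ` N y \<inter> X closure_of V \<noteq> {} \<longrightarrow> g ` N y \<subseteq> U)"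
    using bchoice[OF N] by (elim exE) (rule that)
  \<comment> \<open>A translate that meets \<open>V\<close> meets its closure, so the condition
    passes to \<open>V\<close> itself.\<close>
  have VV: "V \<subseteq> X closure_of V" by (rule closure_of_subset[OF openin_subset[OF V(1)]])
  have "g ` N y \<subseteq> U" if "y \<in> topspace X" "g \<in> G" "g ` N y \<inter> V \<noteq> {}" for y g
  proof -
    have "g ` N y \<inter> X closure_of V \<noteq> {}" using that(3) VV by auto
    then show ?thesis using bspec[OF N that(1)] that(2) by simp
  qed
  then show thesis using that[OF V, of N] N by simp
qed

text \<open>\<open>E\<close> is controlled over an open \<open>V\<close> and not only at
  \<open>x\<close>, so that members of a countable base can later take the place of \<open>V\<close>
  and \<open>U\<close>.\<close>

lemma equiregular_separation:
  assumes "equiregular X G" "openin X U" "x \<in> U"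
  obtains V E where "openin X V" "x \<in> V" "equi_nhd E" "E `` V \<subseteq> U"
proof -
  obtain V N where V: "openin X V" "x \<in> V"
    and N: "\<And>y. y \<in> topspace X \<Longrightarrow> openin X (N y)" "\<And>y. y \<in> topspace X \<Longrightarrow> y \<in> N y"
      "\<And>y g. y \<in> topspace X \<Longrightarrow> g \<in> G \<Longrightarrow> g ` N y \<inter> V \<noteq> {} \<Longrightarrow> g ` N y \<subseteq> U"
    using equiregular_nhds[OF assms] by metis
  \<comment> \<open>The largest relation that sends \<open>V\<close> into \<open>U\<close>. A
    translate of \<open>N y\<close> misses \<open>V\<close> or lies in \<open>U\<close>; in both
    cases its square lies in \<open>E\<close>.\<close>
  define E where "E = {(a, b). a \<in> V \<longrightarrow> b \<in> U}"
  have NE: "g ` N y \<times> g ` N y \<subseteq> E" if "y \<in> topspace X" "g \<in> G" for y g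
    using N(3)[OF that] unfolding E_def by auto
  have "equi_nhd E"
    unfolding equi_nhd_def
  proof
    fix y assume y: "y \<in> topspace X"
    show "\<exists>N. openin X N \<and> y \<in> N \<and> (\<forall>g\<in>G. g ` N \<times> g ` N \<subseteq> E)"
      by (rule exI[of _ "N y"]) (simp add: N y NE)
  qed
  then show thesis by (rule that[OF V]) (auto simp: E_def)
qed

text \<open>
  Equiregularity yields the refinement over a single saturated open set \<open>G V\<close>; a locally finite
  closed cover of the orbit space subordinate to the images of these sets glues the pieces.
\<close>

lemma equi_nhd_refinement:
  assumes "equiregular X G" "paracompact_space (orbit_space X G)"
    "regular_space (orbit_space X G)" "equi_nhd E"
  obtains F where "equi_nhd F" "sym F" "invariant F" "F O F \<subseteq> E"
proof -
  let ?Q = "orbit_space X G" and ?p = "orbit_of G"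
  have "\<forall>x\<in>topspace X. \<exists>M. openin X M \<and> x \<in> M \<and> (\<forall>g\<in>G. g ` M \<times> g ` M \<subseteq> E)"
    using assms(4) unfolding equi_nhd_def .
  then obtain M where M': "\<forall>x\<in>topspace X. openin X (M x) \<and> x \<in> M x \<and>
      (\<forall>g\<in>G. g ` M x \<times> g ` M x \<subseteq> E)"
    by (elim bchoice[THEN exE]) (rule that)
  have M: "openin X (M x)" "x \<in> M x" "\<And>g. g \<in> G \<Longrightarrow> g ` M x \<times> g ` M x \<subseteq> E"
    if "x \<in> topspace X" for x
    using bspec[OF M' that] by simp_all
  \<comment> \<open>Equiregularity at \<open>x\<close> with \<open>M x\<close> as the target; the
    predicate lets \<open>V\<close> and \<open>N\<close> be chosen together.\<close>
  define good where "good x V N \<longleftrightarrow> openin X V \<and> x \<in> V \<and>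
      (\<forall>y\<in>topspace X. openin X (N y) \<and> y \<in> N y \<and>
         (\<forall>g\<in>G. g ` N y \<inter> V \<noteq> {} \<longrightarrow> g ` N y \<subseteq> M x))" for x V N
  have "\<exists>V N. good x V N" if x: "x \<in> topspace X" for x
  proof (rule equiregular_nhds[OF assms(1) M(1,2)[OF x]])
    show ?thesis if "openin X V" "x \<in> V"
      "\<And>y. y \<in> topspace X \<Longrightarrow> openin X (N y)" "\<And>y. y \<in> topspace X \<Longrightarrow> y \<in> N y"
      "\<And>y g. y \<in> topspace X \<Longrightarrow> g \<in> G \<Longrightarrow> g ` N y \<inter> V \<noteq> {} \<Longrightarrow> g ` N y \<subseteq> M x" for V N
      by (intro exI[of _ V] exI[of _ N]) (simp add: good_def that)
  qed
  then obtain V N where VN: "\<And>x. x \<in> topspace X \<Longrightarrow> good x (V x) (N x)"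
    by metis
  have V: "openin X (V x)" "x \<in> V x" if "x \<in> topspace X" for x
    using VN[OF that] by (simp_all add: good_def)
  have N: "openin X (N x y)" "y \<in> N x y"
    if "x \<in> topspace X" "y \<in> topspace X" for x y
    using VN[OF that(1)] that(2) by (simp_all add: good_def)
  have N_M: "g ` N x y \<subseteq> M x"
    if "x \<in> topspace X" "y \<in> topspace X" "g \<in> G" "g ` N x y \<inter> V x \<noteq> {}" for x y g
    using VN[OF that(1)] that(2-) by (simp add: good_def)
  define \<U> where "\<U> = (\<lambda>x. ?p ` V x) ` topspace X"
  have cover: "\<Union>\<U> = topspace ?Q"
  proof
    show "\<Union>\<U> \<subseteq> topspace ?Q"
      using openin_subset[OF V(1)] unfolding topspace_orbit_space \<U>_def
      by (intro UN_least image_mono)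
    show "topspace ?Q \<subseteq> \<Union>\<U>"
      using V(2) unfolding topspace_orbit_space \<U>_def by auto
  qed
  have opn: "\<forall>U\<in>\<U>. openin ?Q U"
    using V(1) openin_orbit_image unfolding \<U>_def by auto
  obtain \<C> where C: "\<And>C. C \<in> \<C> \<Longrightarrow> closedin ?Q C" "\<Union>\<C> = topspace ?Q"
      "\<And>C. C \<in> \<C> \<Longrightarrow> \<exists>U\<in>\<U>. C \<subseteq> U" "locally_finite_in ?Q \<C>"
    by (rule paracompact_regular_closed_refinement[OF assms(2,3) opn cover]) (rule that)
  have "\<exists>x. x \<in> topspace X \<and> C \<subseteq> ?p ` V x" if "C \<in> \<C>" for C
    using C(3)[OF that] unfolding \<U>_def by auto
  then obtain c where c: "\<And>C. C \<in> \<C> \<Longrightarrow> c C \<in> topspace X" "\<And>C. C \<in> \<C> \<Longrightarrow> C \<subseteq> ?p ` V (c C)"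
    by metis
  \<comment> \<open>Local finiteness acts twice: finitely many \<open>C\<close> contain the orbit of
    \<open>y\<close>, so the sets \<open>N (c C) y\<close> can be intersected; the union of the
    other \<open>C\<close> is closed, so its preimage can be removed. Hence any \<open>C\<close>
    containing the orbit of a point of \<open>W y\<close> contains that of \<open>y\<close>.\<close>
  define W where "W y = (\<Inter>C\<in>{C\<in>\<C>. ?p y \<in> C}. N (c C) y) \<inter>
      {z \<in> topspace X. ?p z \<in> topspace ?Q - \<Union>{C\<in>\<C>. ?p y \<notin> C}}" for y
  have W_N: "W y \<subseteq> N (c C) y" if "C \<in> \<C>" "?p y \<in> C" for y C
    using that by (auto simp: W_def)
  have W_C: "?p y \<in> C" if "z \<in> W y" "C \<in> \<C>" "?p z \<in> C" for y z C
    using that by (auto simp: W_def)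
  have W_X: "W y \<subseteq> topspace X" for y by (auto simp: W_def)
  have W: "openin X (W y) \<and> y \<in> W y" if y: "y \<in> topspace X" for y
  proof
    have py: "?p y \<in> topspace ?Q" using y by (simp add: topspace_orbit_space)
    then obtain A where "?p y \<in> A" "finite {C\<in>\<C>. C \<inter> A \<noteq> {}}"
      using conjunct2[OF C(4)[unfolded locally_finite_in_def]] by (elim ballE) auto
    then have fin: "finite {C\<in>\<C>. ?p y \<in> C}" by (elim finite_subset[rotated]) auto
    \<comment> \<open>An intersection over the empty family would be \<open>UNIV\<close>, which need
      not be open in \<open>X\<close>; the cover supplies a member.\<close>
    obtain C0 where C0: "C0 \<in> \<C>" "?p y \<in> C0" using py C(2) by blast
    then have ne: "{C\<in>\<C>. ?p y \<in> C} \<noteq> {}" by blast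
    have op: "openin X (\<Inter>C\<in>{C\<in>\<C>. ?p y \<in> C}. N (c C) y)"
      using fin ne N(1) c(1) y by (intro openin_INT2) auto
    have "closedin ?Q (\<Union>{C\<in>\<C>. ?p y \<notin> C})"
      using C(1) locally_finite_in_subset[OF C(4)] by (intro closedin_locally_finite_Union) auto
    then have "openin ?Q (topspace ?Q - \<Union>{C\<in>\<C>. ?p y \<notin> C})"
      by (simp add: openin_diff)
    then have "openin X {z \<in> topspace X. ?p z \<in> topspace ?Q - \<Union>{C\<in>\<C>. ?p y \<notin> C}}"
      by (simp add: openin_orbit_space)
    then show "openin X (W y)" unfolding W_def by (rule openin_Int[OF op])
    show "y \<in> W y" using y py N(2) c(1) by (auto simp: W_def)
  qed
  define F where "F = (\<Union>y\<in>topspace X. \<Union>g\<in>G. g ` W y \<times> g ` W y)"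
  have "equi_nhd F"
    unfolding equi_nhd_def F_def using W by blast
  moreover have "sym F"
    unfolding F_def by (auto intro!: symI)
  moreover have "invariant F"
    unfolding F_def by (rule invariant_Union[OF W_X])
  moreover have "F O F \<subseteq> E"
  proof clarify
    fix a z b assume "(a, z) \<in> F" "(z, b) \<in> F"
    obtain y g where y: "y \<in> topspace X" "g \<in> G" "a \<in> g ` W y" "z \<in> g ` W y"
      using \<open>(a, z) \<in> F\<close> unfolding F_def by blast
    obtain w h where w: "w \<in> topspace X" "h \<in> G" "z \<in> h ` W w" "b \<in> h ` W w"
      using \<open>(z, b) \<in> F\<close> unfolding F_def by blast
    obtain z1 where "z1 \<in> W y" "z = g z1" using y(4) by (rule imageE)
    then have z: "z \<in> topspace X" using in_topspace[OF y(2)] W_X[of y] by auto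
    then have "?p z \<in> \<Union>\<C>" unfolding C(2) topspace_orbit_space by (rule imageI)
    \<comment> \<open>The middle point \<open>z\<close> selects \<open>C1\<close>, whose centre
      \<open>?x\<close> then serves both links; \<open>k\<close> below moves \<open>z\<close> into
      \<open>V ?x\<close>.\<close>
    then obtain C1 where C1: "C1 \<in> \<C>" "?p z \<in> C1" by (rule UnionE)
    let ?x = "c C1"
    have x: "?x \<in> topspace X" by (rule c(1)[OF C1(1)])
    obtain v where v: "v \<in> V ?x" "?p z = ?p v" using c(2)[OF C1(1)] C1(2) by auto
    have "v \<in> topspace X" using v(1) openin_subset[OF V(1)[OF x]] by (rule subsetD[rotated])
    then have "\<exists>g\<in>G. g z = v" using orbit_of_eq_iff[OF z, of v] v(2) by simp
    then obtain k where k: "k \<in> G" "k z = v" by (rule bexE)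
    \<comment> \<open>\<open>C1\<close> contains the orbit of \<open>z\<close>, hence that of
      \<open>u\<close>, so \<open>W u\<close> lies in \<open>N ?x u\<close>. The translate of
      \<open>N ?x u\<close> by the product of \<open>k\<close> and \<open>f\<close> contains
      \<open>v\<close>, so it meets \<open>V ?x\<close> and lies in \<open>M ?x\<close>.\<close>
    have key: "t \<in> topspace X \<and> k t \<in> M ?x"
      if u: "u \<in> topspace X" "f \<in> G" "z \<in> f ` W u" "t \<in> f ` W u" for u f t
    proof -
      obtain z' where z': "z = f z'" "z' \<in> W u" using u(3) by (rule imageE)
      obtain t' where t': "t = f t'" "t' \<in> W u" using u(4) by (rule imageE)
      have X': "z' \<in> topspace X" "t' \<in> topspace X"
        using z'(2) t'(2) W_X[of u] by auto
      have "?p z' \<in> C1" using C1(2) z'(1) orbit_of_image[OF u(2) X'(1)] by simp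
      then have "?p u \<in> C1" by (rule W_C[OF z'(2) C1(1)])
      then have zN: "z' \<in> N ?x u" "t' \<in> N ?x u"
        using W_N[OF C1(1)] z'(2) t'(2) by auto
      obtain l where l: "l \<in> G" "\<And>x. x \<in> topspace X \<Longrightarrow> l x = k (f x)"
        using ex_mult[OF k(1) u(2)] by metis
      have lv: "l z' = v" "l t' = k t"
        using l(2)[OF X'(1)] l(2)[OF X'(2)] z'(1) t'(1) k(2) by simp_all
      then have "v \<in> l ` N ?x u" using zN(1) by (metis imageI)
      then have "l ` N ?x u \<inter> V ?x \<noteq> {}" using v(1) by auto
      then have "l ` N ?x u \<subseteq> M ?x" by (rule N_M[OF x u(1) l(1)])
      then have "k t \<in> M ?x" using zN(2) lv(2) by (metis imageI subsetD)
      then show ?thesis using in_topspace[OF u(2) X'(2)] t'(1) by simp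
    qed
    \<comment> \<open>Undoing \<open>k\<close> puts \<open>a\<close> and \<open>b\<close> into one
      translate of \<open>M ?x\<close>, whose square lies in \<open>E\<close>.\<close>
    obtain m where m: "m \<in> G" "\<And>x. x \<in> topspace X \<Longrightarrow> m (k x) = x"
      using ex_inv[OF k(1)] by metis
    have a: "a \<in> topspace X \<and> k a \<in> M ?x" by (rule key[OF y(1,2,4,3)])
    have b: "b \<in> topspace X \<and> k b \<in> M ?x" by (rule key[OF w])
    have "a \<in> m ` M ?x" "b \<in> m ` M ?x" using m(2) a b by (metis imageI)+
    then show "(a, b) \<in> E" using M(3)[OF x m(1)] by auto
  qed
  ultimately show thesis by (rule that)
qed

text \<open>Two refinements suffice: \<open>H O H \<subseteq> F\<close> and
  \<open>H \<subseteq> F\<close> put the triple composition of \<open>H\<close> into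
  \<open>F O F\<close>, hence into \<open>E\<close>. The plain inclusions come from padding with a
  loop at the endpoint, which invariance places in \<open>topspace X\<close>.\<close>

lemma equi_nhd_refinement3:
  assumes "equiregular X G" "paracompact_space (orbit_space X G)"
    "regular_space (orbit_space X G)" "equi_nhd E"
  obtains F where "equi_nhd F" "sym F" "invariant F" "F \<subseteq> E" "F O F O F \<subseteq> E"
proof -
  obtain F where F: "equi_nhd F" "invariant F" "F O F \<subseteq> E"
    using equi_nhd_refinement[OF assms] by blast
  obtain H where H: "equi_nhd H" "sym H" "invariant H" "H O H \<subseteq> F"
    using equi_nhd_refinement[OF assms(1-3) F(1)] by blast
  have "H \<subseteq> F"
  proof clarify
    fix x y assume xy: "(x, y) \<in> H"
    then have "y \<in> topspace X" using H(3) by (auto simp: invariant_def)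
    then show "(x, y) \<in> F" using equi_nhd_refl[OF H(1)] xy H(4) by blast
  qed
  moreover have "F \<subseteq> E"
  proof clarify
    fix x y assume xy: "(x, y) \<in> F"
    then have "y \<in> topspace X" using F(2) by (auto simp: invariant_def)
    then show "(x, y) \<in> E" using equi_nhd_refl[OF F(1)] xy F(3) by blast
  qed
  ultimately show thesis using H F(3) that[of H] by blast
qed

text \<open>One relation is kept for each pair of basic sets that some equi-neighbourhood separates.
  For \<open>x\<close> in \<open>U\<close>, a basic \<open>B'\<close> inside \<open>U\<close> and a
  basic \<open>A\<close> inside the \<open>V\<close> that \<open>equiregular_separation\<close>
  gives for \<open>B'\<close> form such a pair.\<close>

lemma countable_separating_equi_nhds:
  assumes "equiregular X G" "second_countable X"
  obtains E :: "nat \<Rightarrow> 'a rel" where "\<And>k. equi_nhd (E k)"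
    "\<And>U x. openin X U \<Longrightarrow> x \<in> U \<Longrightarrow> \<exists>k. E k `` {x} \<subseteq> U"
proof -
  obtain \<B> where B: "countable \<B>" "\<forall>V\<in>\<B>. openin X V"
      "\<forall>U x. openin X U \<and> x \<in> U \<longrightarrow> (\<exists>V\<in>\<B>. x \<in> V \<and> V \<subseteq> U)"
    using assms(2) unfolding second_countable_def by (elim exE conjE) (rule that)
  have base: thesis
    if "openin X U" "x \<in> U" "\<And>V. V \<in> \<B> \<Longrightarrow> x \<in> V \<Longrightarrow> V \<subseteq> U \<Longrightarrow> thesis" for U x thesis
    using B(3)[THEN spec, THEN spec, THEN mp, OF conjI, OF that(1,2)] that(3) by auto
  \<comment> \<open>The default \<open>UNIV\<close> makes \<open>D A B\<close> an equi-neighbourhood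
    for every pair.\<close>
  define D where "D A B = (if \<exists>E. equi_nhd E \<and> E `` A \<subseteq> B
      then SOME E. equi_nhd E \<and> E `` A \<subseteq> B else UNIV)" for A B :: "'a set"
  have D: "equi_nhd (D A B) \<and> D A B `` A \<subseteq> B" if "equi_nhd E" "E `` A \<subseteq> B" for A B E
  proof -
    have ex: "\<exists>E. equi_nhd E \<and> E `` A \<subseteq> B" using that by blast
    then show ?thesis unfolding D_def using someI_ex[OF ex] by simp
  qed
  have D': "equi_nhd (D A B)" for A B
  proof (cases "\<exists>E. equi_nhd E \<and> E `` A \<subseteq> B")
    case True
    then show ?thesis using D by blast
  next
    case False
    then show ?thesis by (simp only: D_def if_False equi_nhd_UNIV)
  qed
  \<comment> \<open>Inserting \<open>UNIV\<close> keeps the family nonempty, as its enumeration by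
    \<open>from_nat_into\<close> requires.\<close>
  define \<E> where "\<E> = insert UNIV ((\<lambda>(A, B). D A B) ` (\<B> \<times> \<B>))"
  have cnt: "countable \<E>" "\<E> \<noteq> {}" using B(1) by (auto simp: \<E>_def)
  have nhd: "equi_nhd E" if "E \<in> \<E>" for E
    using that D' equi_nhd_UNIV by (auto simp: \<E>_def)
  have sep: "\<exists>E\<in>\<E>. E `` {x} \<subseteq> U" if U: "openin X U" "x \<in> U" for U x
  proof -
    obtain B' where B': "B' \<in> \<B>" "x \<in> B'" "B' \<subseteq> U" by (rule base[OF U])
    have "openin X B'" using B(2) B'(1) by (rule bspec)
    then obtain V E where V: "openin X V" "x \<in> V" "equi_nhd E" "E `` V \<subseteq> B'"
      using B'(2) by (rule equiregular_separation[OF assms(1)])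
    obtain A where A: "A \<in> \<B>" "x \<in> A" "A \<subseteq> V" by (rule base[OF V(1,2)])
    then have "E `` A \<subseteq> B'" using V(4) by blast
    then have "D A B' `` A \<subseteq> B'" using D[OF V(3)] by blast
    then have "D A B' `` {x} \<subseteq> U" using A(2) B'(3) by blast
    moreover have "D A B' \<in> \<E>" using A(1) B'(1) by (force simp: \<E>_def)
    ultimately show ?thesis by (rule bexI)
  qed
  show thesis
  proof (rule that[of "from_nat_into \<E>"])
    show "equi_nhd (from_nat_into \<E> k)" for k
      by (rule nhd[OF from_nat_into[OF cnt(2)]])
    show "\<exists>k. from_nat_into \<E> k `` {x} \<subseteq> U" if "openin X U" "x \<in> U" for U x
      using sep[OF that] from_nat_into_surj[OF cnt(1)] by metis
  qed
qed

text \<open>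
  The identity is added to make the relations reflexive on the whole type; accordingly the group
  elements, which are undefined off \<open>topspace X\<close>, are extended by the identity.
\<close>

lemma invariant_frink_sequence:
  assumes "equiregular X G" "paracompact_space (orbit_space X G)"
    "regular_space (orbit_space X G)" "second_countable X"
  obtains F where "frink_sequence F" "\<And>n. equi_nhd (F n)"
    "\<And>n g x y. g \<in> G \<Longrightarrow> (x, y) \<in> F n \<Longrightarrow>
       ((if x \<in> topspace X then g x else x), (if y \<in> topspace X then g y else y)) \<in> F n"
    "\<And>U x. openin X U \<Longrightarrow> x \<in> U \<Longrightarrow> \<exists>n. F n `` {x} \<subseteq> U"
proof -
  obtain E :: "nat \<Rightarrow> 'a rel" where E: "\<And>k. equi_nhd (E k)"
      "\<And>U x. openin X U \<Longrightarrow> x \<in> U \<Longrightarrow> \<exists>k. E k `` {x} \<subseteq> U"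
    using countable_separating_equi_nhds[OF assms(1,4)] by blast
  define P where "P H \<longleftrightarrow> equi_nhd H \<and> sym H \<and> invariant H" for H
  \<comment> \<open>Step \<open>n\<close> also shrinks below \<open>E n\<close>, so the sequence
    refines every separating relation.\<close>
  have "\<exists>H. \<forall>n. P (H n) \<and> (H (Suc n) \<subseteq> H n \<inter> E n \<and>
          H (Suc n) O H (Suc n) O H (Suc n) \<subseteq> H n \<inter> E n)"
  proof (rule dependent_nat_choice)
    obtain H where "P H"
      using equi_nhd_refinement[OF assms(1-3) equi_nhd_UNIV] unfolding P_def by blast
    then show "\<exists>H. P H" ..
    show "\<exists>H'. P H' \<and> H' \<subseteq> H \<inter> E n \<and> H' O H' O H' \<subseteq> H \<inter> E n" if "P H" for H n
      using equi_nhd_refinement3[OF assms(1-3) equi_nhd_Int[of H "E n"]] E(1) that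
      unfolding P_def by metis
  qed
  then obtain H where H: "\<And>n. P (H n)" "\<And>n. H (Suc n) \<subseteq> H n \<inter> E n"
      "\<And>n. H (Suc n) O H (Suc n) O H (Suc n) \<subseteq> H n \<inter> E n"
    by blast
  define F where "F n = (if n = 0 then UNIV else H n \<union> Id)" for n
  \<comment> \<open>If the endpoints differ, at least one link is genuine, so all four points lie in
    \<open>topspace X\<close>. There \<open>R\<close> is reflexive, and identity links become links
    of \<open>R\<close>.\<close>
  have comp: "(R \<union> Id) O (R \<union> Id) O (R \<union> Id) \<subseteq> S \<union> Id"
    if R: "R O R O R \<subseteq> S" "refl_on (topspace X) R" "R \<subseteq> topspace X \<times> topspace X"
    for R S :: "'a rel"
  proof (rule subrelI)
    fix x y assume "(x, y) \<in> (R \<union> Id) O (R \<union> Id) O (R \<union> Id)"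
    then obtain u v where uv: "(x, u) \<in> R \<union> Id" "(u, v) \<in> R \<union> Id" "(v, y) \<in> R \<union> Id"
      by auto
    show "(x, y) \<in> S \<union> Id"
    proof (cases "x = y")
      case False
      then have "{x, u, v, y} \<subseteq> topspace X" using uv R(3) by auto
      then have "(x, u) \<in> R" "(u, v) \<in> R" "(v, y) \<in> R"
        using uv R(2) by (auto dest: refl_onD)
      then have "(x, y) \<in> R O R O R" by blast
      then show ?thesis using R(1) by (auto dest: subsetD)
    qed simp
  qed
  show thesis
  proof (rule that[of F])
    show "frink_sequence F"
    proof
      show "sym (F n)" for n
        using H(1)[of n] by (auto simp: F_def P_def sym_def)
      have "(H (Suc n) \<union> Id) O (H (Suc n) \<union> Id) O (H (Suc n) \<union> Id) \<subseteq> H n \<union> Id" for n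
        using H(1)[of "Suc n"] H(2)[of n] H(3)[of n] equi_nhd_refl[of "H (Suc n)"]
        by (intro comp) (auto simp: P_def invariant_def refl_on_def)
      then show "F (Suc n) O F (Suc n) O F (Suc n) \<subseteq> F n" for n
        by (simp add: F_def)
    qed (auto simp: F_def)
    show "equi_nhd (F n)" for n
      using H(1)[of n] equi_nhd_UNIV equi_nhd_mono[of "H n" "H n \<union> Id"]
      by (simp add: F_def P_def)
    show "((if x \<in> topspace X then g x else x), (if y \<in> topspace X then g y else y)) \<in> F n"
      if "g \<in> G" "(x, y) \<in> F n" for n g x y
      using that H(1)[of n] by (fastforce simp: F_def P_def invariant_def split: if_splits)
    show "\<exists>n. F n `` {x} \<subseteq> U" if U: "openin X U" "x \<in> U" for U x
    proof -
      obtain k where "E k `` {x} \<subseteq> U" using E(2) U by blast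
      \<comment> \<open>The index shifts by one because \<open>H (Suc k)\<close> lies in
        \<open>E k\<close>; the added diagonal contributes only \<open>x\<close>, which is in
        \<open>U\<close>.\<close>
      then have "F (Suc k) `` {x} \<subseteq> U" using H(2)[of k] U(2) by (auto simp: F_def)
      then show ?thesis ..
    qed
  qed
qed

end

section \<open>The invariant metric\<close>

theorem mainTheorem2:
  fixes X :: "'a topology" and G :: "('a \<Rightarrow> 'a) set"
  assumes "separable_space X"
    and "metrizable_space X"
    and "homeomorphism_group_on X G"
    and "paracompact_space (orbit_space X G)"
    and "regular_space (orbit_space X G)"
    and "equiregular X G"
  shows "singly_isometrizable X G"
proof -
  interpret homeo_group X G by standard (rule assms(3))
  obtain F where "frink_sequence F" and F: "\<And>n. equi_nhd (F n)"
    "\<And>n g x y. g \<in> G \<Longrightarrow> (x, y) \<in> F n \<Longrightarrow>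
       ((if x \<in> topspace X then g x else x), (if y \<in> topspace X then g y else y)) \<in> F n"
    "\<And>U x. openin X U \<Longrightarrow> x \<in> U \<Longrightarrow> \<exists>n. F n `` {x} \<subseteq> U"
    using invariant_frink_sequence[OF assms(6,4,5)
        separable_metrizable_imp_second_countable[OF assms(1,2)]] by blast
  interpret frink_sequence F by fact
  let ?d = "chain_dist F"
  \<comment> \<open>This half of the comparison of topologies comes first because definiteness of
    the metric depends on it.\<close>
  have sep: "\<exists>r>0. \<forall>y. ?d x y < r \<longrightarrow> y \<in> U" if "openin X U" "x \<in> U" for U x
  proof -
    obtain n where n: "F n `` {x} \<subseteq> U" using F(3) \<open>openin X U\<close> \<open>x \<in> U\<close> by blast
    have "y \<in> U" if "?d x y < (1/2) ^ n" for y
      using chain_dist_less_power[OF that] n by blast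
    then show ?thesis by (intro exI[of _ "(1/2) ^ n"]) simp
  qed
  interpret M: Metric_space "topspace X" ?d
  proof
    fix x y assume xy: "x \<in> topspace X" "y \<in> topspace X"
    have "x = y" if "?d x y = 0"
    proof (rule ccontr)
      assume "x \<noteq> y"
      \<comment> \<open>Points of a metrizable space are closed, so by \<open>sep\<close> some ball
        about \<open>x\<close> misses \<open>y\<close>.\<close>
      have "openin X (topspace X - {y})"
        using metrizable_imp_t1_space[OF assms(2)] xy
        by (simp add: t1_space_openin_delete_alt)
      then obtain r where r: "r > 0" "\<forall>z. ?d x z < r \<longrightarrow> z \<in> topspace X - {y}"
        using sep[of "topspace X - {y}" x] xy \<open>x \<noteq> y\<close> by auto
      have "?d x y < r" using that r(1) by simp
      then show False using r(2) by blast
    qed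
    then show "?d x y = 0 \<longleftrightarrow> x = y" by (auto simp: chain_dist_self)
  qed (auto simp: chain_dist_nonneg chain_dist_triangle intro: chain_dist_commute)
  have "openin M.mtopology U \<longleftrightarrow> openin X U" for U
  proof
    assume U: "openin X U"
    show "openin M.mtopology U"
      unfolding M.openin_mtopology
    proof (intro conjI allI impI)
      fix x assume "x \<in> U"
      then obtain r where "r > 0" "\<forall>y. ?d x y < r \<longrightarrow> y \<in> U" using sep U by blast
      then show "\<exists>r>0. M.mball x r \<subseteq> U" by (intro exI[of _ r]) auto
    qed (rule openin_subset[OF U])
  next
    assume U: "openin M.mtopology U"
    show "openin X U"
    proof (subst openin_subopen, intro ballI)
      fix x assume "x \<in> U"
      then obtain r where x: "x \<in> topspace X" and r: "r > 0" "M.mball x r \<subseteq> U"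
        using U unfolding M.openin_mtopology by blast
      obtain n where n: "(1/2) ^ n < r" using real_arch_pow_inv[OF r(1)] by fastforce
      obtain N where N: "openin X N" "x \<in> N" "\<And>y. y \<in> N \<Longrightarrow> (x, y) \<in> F n"
        using equi_nhd_nhd[OF F(1) x] by metis
      have "N \<subseteq> M.mball x r"
      proof
        fix y assume "y \<in> N"
        then have "?d x y < r" using chain_dist_le_power[OF N(3)] n by fastforce
        then show "y \<in> M.mball x r" using x \<open>y \<in> N\<close> openin_subset[OF N(1)] by auto
      qed
      then show "\<exists>T. openin X T \<and> x \<in> T \<and> T \<subseteq> U" using N r by blast
    qed
  qed
  then have "M.mtopology = X" by (simp add: topology_eq)
  moreover have "?d (g x) (g y) = ?d x y"
    if g: "g \<in> G" and xy: "x \<in> topspace X" "y \<in> topspace X" for g x y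
  proof (rule antisym)
    \<comment> \<open>One inequality for all group elements, extended by the identity; an inverse of
      \<open>g\<close> then gives the reverse inequality.\<close>
    have le: "?d (g x) (g y) \<le> ?d x y" if "g \<in> G" "x \<in> topspace X" "y \<in> topspace X" for g x y
      using chain_dist_map[of "\<lambda>x. if x \<in> topspace X then g x else x" x y] F(2) that by simp
    show "?d (g x) (g y) \<le> ?d x y" by (rule le[OF g xy])
    obtain h where "h \<in> G" "\<And>x. x \<in> topspace X \<Longrightarrow> h (g x) = x" using ex_inv[OF g] by metis
    then show "?d x y \<le> ?d (g x) (g y)"
      using le[of h "g x" "g y"] in_topspace[OF g] xy by simp
  qed
  ultimately show ?thesis
    unfolding singly_isometrizable_def using M.Metric_space_axioms by blast
qed

end
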